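(* Let $\mathcal C\subset\mathbb R^n$ and $\mathcal Q\subset\mathbb R^m$ be nonempty closed sets, and let $\Psi:\mathbb R^{m\times n}\times\mathbb R^m\rightrightarrows\mathbb R^n$ be the solution map of the nonhomogeneous split feasibility problem, $$\Psi(A,b):=\{x\in\mathcal C : Ax+b\in\mathcal Q\}.$$ Let $(\bar A,\bar b)\in\mathbb R^{m\times n}\times\mathbb R^m$ be given and let $\bar x\in\Psi(\bar A,\bar b)$. Suppose that $\mathcal C$ is normally regular at $\bar x$ and $\mathcal Q$ is normally regular at $\bar A\bar x+\bar b$. Consider the regularity condition $$(\ast)\qquad \big(\bar A^{\rm T}\big)^{-1}\big(-N(\bar x;\mathcal C)\big)\cap N(\bar A\bar x+\bar b;\mathcal Q)=\{0\}.$$ If $(\ast)$ holds, then $\Psi$ is Lipschitz-like at $\big((\bar A,\bar b),\bar x\big)$. Conversely, if $\Psi$ is Lipschitz-like at $\big((\bar A,\bar b),\bar x\big)$ and if $\bar x\neq0$, then $(\ast)$ is valid.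
   Context: All spaces are finite-dimensional Euclidean spaces (spaces of matrices carry the inner product $\langle A',A\rangle=\sum_{i,j}a'_{ij}a_{ij}$); products carry the sum norm. $M^{\rm T}$ is the transpose of a matrix $M$, and for a set $\Omega$, $M^{-1}(\Omega)=\{x: Mx\in\Omega\}$ denotes the preimage (so $(\bar A^{\rm T})^{-1}(\cdot)$ is a subset of $\mathbb R^m$; no invertibility is assumed). Normal cones: for nonempty $\Omega\subset\mathbb R^p$ and $\bar x\in\Omega$, the regular (Fréchet) normal cone is $$\widehat N(\bar x;\Omega)=\Big\{x'\in\mathbb R^p : \limsup_{x\to\bar x,\,x\in\Omega}\frac{\langle x',x-\bar x\rangle}{\|x-\bar x\|}\le 0\Big\},$$ and the limiting (Mordukhovich) normal cone $N(\bar x;\Omega)$ is the set of all $x'\in\mathbb R^p$ for which there exist sequences $x_k\to\bar x$, $x'_k\to x'$ with $x'_k\in\widehat N(x_k;\Omega)$ for all $k$. Both are set to $\emptyset$ when the base point is not in $\Omega$. The set $\Omega$ is normally regular at $\bar x\in\Omega$ if $\widehat N(\bar x;\Omega)=N(\bar x;\Omega)$. Lipschitz-likeness (Aubin property): a set-valued map $F:X\rightrightarrows Y$ between finite-dimensional spaces is Lipschitz-like at $(\bar x,\bar y)$ with $\bar y\in F(\bar x)$ if there exist neighborhoods $U$ of $\bar x$, $V$ of $\bar y$ and a constant $\ell>0$ such that $F(x')\cap V\subset F(x)+\ell\|x'-x\|\,\overline{\mathbb B}_Y$ for all $x',x\in U$, where $\overline{\mathbb B}_Y$ is the closed unit ball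 of $Y$. *)

theory Defs
  imports "HOL-Analysis.Analysis"
begin

text \<open>
  The upper limit is taken in the extended reals along the punctured filter.  At an isolated point
  of \<open>\<Omega>\<close> this filter is trivial, the upper limit is \<open>-\<infinity>\<close>, and the cone is the whole space.
\<close>

definition regular_normal_cone :: "'a::euclidean_space \<Rightarrow> 'a set \<Rightarrow> 'a set"
  where "regular_normal_cone xb \<Omega> =
    (if xb \<in> \<Omega>
     then {x'. Limsup (at xb within \<Omega>) (\<lambda>x. ereal (inner x' (x - xb) / norm (x - xb))) \<le> 0}
     else {})"

text \<open>
  The points \<open>X k\<close> lie in \<open>\<Omega>\<close> automatically, since the regular normal cone is empty elsewhere.
\<close>

definition limiting_normal_cone :: "'a::euclidean_space \<Rightarrow> 'a set \<Rightarrow> 'a set"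
  where "limiting_normal_cone xb \<Omega> =
    (if xb \<in> \<Omega>
     then {x'. \<exists>X X'. X \<longlonglongrightarrow> xb \<and> X' \<longlonglongrightarrow> x' \<and> (\<forall>k::nat. X' k \<in> regular_normal_cone (X k) \<Omega>)}
     else {})"

definition normally_regular_at :: "'a::euclidean_space set \<Rightarrow> 'a \<Rightarrow> bool"
  where "normally_regular_at \<Omega> xb \<longleftrightarrow>
    xb \<in> \<Omega> \<and> regular_normal_cone xb \<Omega> = limiting_normal_cone xb \<Omega>"

text \<open>
  The norm \<open>\<nu>\<close> of the domain space is a parameter, because product spaces are to carry the sum norm
  whereas the library's norm on pairs is the Euclidean one.  The topology, hence the notion of
  neighborhood, is the same for both.
\<close>

definition lipschitz_like_at ::
    "('a::euclidean_space \<Rightarrow> real) \<Rightarrow> ('a \<Rightarrow> 'b::euclidean_space set) \<Rightarrow> 'a \<Rightarrow> 'b \<Rightarrow> bool"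
  where "lipschitz_like_at \<nu> F xb yb \<longleftrightarrow>
    yb \<in> F xb \<and>
    (\<exists>U V \<kappa>. open U \<and> xb \<in> U \<and> open V \<and> yb \<in> V \<and> \<kappa> > 0 \<and>
      (\<forall>x'\<in>U. \<forall>x\<in>U. F x' \<inter> V \<subseteq> {y + (\<kappa> * \<nu> (x' - x)) *\<^sub>R u |y u. y \<in> F x \<and> u \<in> cball 0 1}))"

definition sum_norm :: "'a::real_normed_vector \<times> 'b::real_normed_vector \<Rightarrow> real"
  where "sum_norm p = norm (fst p) + norm (snd p)"

text \<open>
  The library's inner product on \<^typ>\<open>real ^ 'n ^ 'm\<close> is the entrywise one, and its norm the
  Frobenius norm.
\<close>

definition split_feasibility_map ::
    "(real ^ 'n) set \<Rightarrow> (real ^ 'm) set \<Rightarrow> (real ^ 'n ^ 'm) \<times> (real ^ 'm) \<Rightarrow> (real ^ 'n) set"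
  where "split_feasibility_map C Q = (\<lambda>(A, b). {x \<in> C. A *v x + b \<in> Q})"

end

theory Submission
  imports Defs
begin

text \<open>
  Sufficiency: by compactness, the qualification condition keeps the vectors \<open>-A'\<^sup>T v\<close> and \<open>v\<close>, with
  \<open>v\<close> of norm one, uniformly away from being simultaneously regular normals to \<open>C\<close> and \<open>Q\<close> near the
  reference point.  Given a solution \<open>x'\<close> for one parameter, put \<open>y' = A' x' + b'\<close> and minimise over
  \<open>C \<times> Q\<close> the residual \<open>\<parallel>A'' x + b'' - y\<parallel>\<close> for the other parameter plus a small multiple of the
  squared distance to \<open>(x', y')\<close>.  At a minimiser with positive residual the first-order conditions
  would produce such almost normal vectors, so the residual vanishes there; the minimiser stays at a
  distance from \<open>x'\<close> that is proportional to the initial residual.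

  Necessity: shifting only \<open>b\<close> by \<open>t v\<close> and adding up the two defining inequalities of the regular
  normals \<open>-A\<^sup>T v\<close> and \<open>v\<close> along the nearby solutions gives \<open>t \<parallel>v\<parallel>\<^sup>2 \<le> o(t)\<close>.
\<close>

section \<open>Regular and limiting normal cones\<close>

text \<open>Replaces the extended-real upper limit by an epsilon-delta estimate. Multiplying by the
  norm admits \<open>x = xb\<close>, where both sides vanish; at an isolated point the estimate
  holds for every \<open>x'\<close>.\<close>

lemma regular_normal_cone_iff:
  "x' \<in> regular_normal_cone xb \<Omega> \<longleftrightarrow>
    xb \<in> \<Omega> \<and> (\<forall>e>0. \<exists>d>0. \<forall>x\<in>\<Omega>. norm (x - xb) < d \<longrightarrow> inner x' (x - xb) \<le> e * norm (x - xb))"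
    (is "?L \<longleftrightarrow> xb \<in> \<Omega> \<and> ?R")
proof (cases "xb \<in> \<Omega>")
  case True
  let ?q = "\<lambda>x. inner x' (x - xb) / norm (x - xb)"
  have "?L \<longleftrightarrow> (\<forall>y>0. \<forall>\<^sub>F x in at xb within \<Omega>. ereal (?q x) < y)"
    using True by (simp add: regular_normal_cone_def Limsup_le_iff)
  also have "\<dots> \<longleftrightarrow> (\<forall>e>0. \<forall>\<^sub>F x in at xb within \<Omega>. ?q x < e)"
  proof safe
    fix e :: real
    assume *: "\<forall>y>0. \<forall>\<^sub>F x in at xb within \<Omega>. ereal (?q x) < y" and "e > 0"
    then show "\<forall>\<^sub>F x in at xb within \<Omega>. ?q x < e"
      using *[rule_format, of "ereal e"] by simp
  next
    fix y :: ereal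
    assume *: "\<forall>e>0. \<forall>\<^sub>F x in at xb within \<Omega>. ?q x < e" and "y > 0"
    \<comment> \<open>A real number lies strictly between \<open>0\<close> and \<open>y\<close>,
      even for \<open>y = \<infinity>\<close>, so real thresholds suffice.\<close>
    then obtain e where "0 < ereal e" "ereal e < y"
      using ereal_dense2 by blast
    then have "\<forall>\<^sub>F x in at xb within \<Omega>. ?q x < e"
      using *[rule_format, of e] by simp
    then show "\<forall>\<^sub>F x in at xb within \<Omega>. ereal (?q x) < y"
    proof (rule eventually_mono)
      show "ereal (?q x) < y" if "?q x < e" for x
        using that \<open>ereal e < y\<close> less_trans[of "ereal (?q x)" "ereal e" y] by simp
    qed
  qed
  also have "\<dots> \<longleftrightarrow> ?R"
  proof safe
    fix e :: real
    assume "\<forall>e>0. \<forall>\<^sub>F x in at xb within \<Omega>. ?q x < e" and "e > 0"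
    then obtain d where d: "d > 0" "\<And>x. x \<in> \<Omega> \<Longrightarrow> x \<noteq> xb \<Longrightarrow> norm (x - xb) < d \<Longrightarrow> ?q x < e"
      unfolding eventually_at dist_norm by blast
    have "inner x' (x - xb) \<le> e * norm (x - xb)" if "x \<in> \<Omega>" "norm (x - xb) < d" for x
      using d(2)[of x] that by (cases "x = xb") (auto simp: divide_simps)
    then show "\<exists>d>0. \<forall>x\<in>\<Omega>. norm (x - xb) < d \<longrightarrow> inner x' (x - xb) \<le> e * norm (x - xb)"
      using d(1) by blast
  next
    fix e :: real
    assume R: ?R and "e > 0"
    \<comment> \<open>Halving \<open>e\<close> turns the non-strict estimate into a strict
      one.\<close>
    then obtain d where d: "d > 0"
      "\<And>x. x \<in> \<Omega> \<Longrightarrow> norm (x - xb) < d \<Longrightarrow> inner x' (x - xb) \<le> (e / 2) * norm (x - xb)"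
      using R[rule_format, of "e / 2"] by auto
    have "?q x < e" if "x \<in> \<Omega>" "x \<noteq> xb" "norm (x - xb) < d" for x
    proof -
      have "?q x \<le> e / 2"
        using d(2)[of x] that by (simp add: divide_simps)
      then show ?thesis
        using \<open>e > 0\<close> by linarith
    qed
    then show "\<forall>\<^sub>F x in at xb within \<Omega>. ?q x < e"
      unfolding eventually_at dist_norm using d(1) by blast
  qed
  finally show ?thesis
    using True by simp
qed (simp add: regular_normal_cone_def)

lemma limiting_normal_coneI:
  assumes "xb \<in> \<Omega>" "X \<longlonglongrightarrow> xb" "X' \<longlonglongrightarrow> x'"
    and "\<And>k. X' k \<in> regular_normal_cone (X k) \<Omega>"
  shows "x' \<in> limiting_normal_cone xb \<Omega>"
  using assms by (auto simp: limiting_normal_cone_def)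

lemma zero_in_limiting_normal_cone:
  assumes "xb \<in> \<Omega>"
  shows "0 \<in> limiting_normal_cone xb \<Omega>"
proof -
  have "0 \<in> regular_normal_cone xb \<Omega>"
    using assms by (auto simp: regular_normal_cone_iff intro: exI[of _ 1])
  then show ?thesis
    by (rule limiting_normal_coneI[OF assms tendsto_const tendsto_const])
qed

text \<open>Fermat's rule: minimality gives \<open>0 \<le> f z - f x\<close>, and the derivative
  replaces this difference by \<open>inner g (z - x)\<close> up to an error
  \<open>e * norm (z - x)\<close>.\<close>

lemma minimiser_regular_normal:
  assumes f: "(f has_derivative (\<lambda>h. inner g h)) (at x)"
    and x: "x \<in> \<Omega>" "\<And>z. z \<in> \<Omega> \<Longrightarrow> f x \<le> f z"
  shows "- g \<in> regular_normal_cone x \<Omega>"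
  unfolding regular_normal_cone_iff
proof (intro conjI allI impI)
  fix e :: real assume "e > 0"
  then obtain d where "d > 0"
    and d: "\<And>z. norm (z - x) < d \<Longrightarrow> norm (f z - f x - inner g (z - x)) \<le> e * norm (z - x)"
    using f unfolding has_derivative_at_alt by blast
  have "inner (- g) (z - x) \<le> e * norm (z - x)" if "z \<in> \<Omega>" "norm (z - x) < d" for z
    using d[OF that(2)] x(2)[OF that(1)] by (simp add: abs_le_iff)
  with \<open>d > 0\<close>
  show "\<exists>d>0. \<forall>z\<in>\<Omega>. norm (z - x) < d \<longrightarrow> inner (- g) (z - x) \<le> e * norm (z - x)"
    by blast
qed (rule x)

section \<open>Matrix-vector products and the Frobenius norm\<close>

text \<open>Cauchy-Schwarz in each row; the row norms then combine to the Frobenius norm.\<close>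

lemma norm_matrix_vector_mult_le:
  fixes A :: "real ^ 'n ^ 'm"
  shows "norm (A *v x) \<le> norm A * norm x"
proof -
  have "norm (A *v x) \<le> L2_set (\<lambda>i. norm (A $ i) * norm x) UNIV"
    unfolding norm_vec_def[of "A *v x"]
  proof (rule L2_set_mono)
    fix i
    have "(A *v x) $ i = inner (A $ i) x"
      by (simp add: matrix_vector_mult_def inner_vec_def)
    then show "norm ((A *v x) $ i) \<le> norm (A $ i) * norm x"
      by (simp add: Cauchy_Schwarz_ineq2)
  qed simp
  also have "\<dots> = norm A * norm x"
    unfolding norm_vec_def[of A] by (simp add: L2_set_left_distrib)
  finally show ?thesis .
qed

lemma bounded_bilinear_matrix_vector_mult:
  "bounded_bilinear ((*v) :: real ^ 'n ^ 'm \<Rightarrow> _)"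
proof
  show "\<exists>K. \<forall>(A :: real ^ 'n ^ 'm) x. norm (A *v x) \<le> norm A * norm x * K"
    by (intro exI[of _ 1]) (simp add: norm_matrix_vector_mult_le)
qed (simp_all add: matrix_vector_mult_add_rdistrib matrix_vector_right_distrib
       matrix_vector_mult_scaleR scaleR_matrix_vector_assoc)

lemma inner_transpose_matrix_vector:
  fixes A :: "real ^ 'n ^ 'm"
  shows "inner (transpose A *v v) x = inner v (A *v x)"
  by (simp add: dot_lmul_matrix)

section \<open>Sufficiency of the qualification condition\<close>

text \<open>If no \<open>\<delta>\<close> worked, the violations for
  \<open>\<delta> = 1 / (k + 1)\<close> would accumulate at a unit vector that the qualification
  condition forces to be zero. The errors \<open>p\<close> and \<open>q\<close> leave room for the
  gradients of the penalty in the minimisation argument.\<close>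

lemma uniform_qualification:
  fixes A :: "real ^ 'n ^ 'm"
  assumes xb: "xb \<in> C" and yb: "yb \<in> Q"
    and cq: "\<And>v. - (transpose A *v v) \<in> limiting_normal_cone xb C \<Longrightarrow>
                 v \<in> limiting_normal_cone yb Q \<Longrightarrow> v = 0"
  obtains \<delta> where "\<delta> > 0"
    and "\<And>x y B v p q. norm (x - xb) \<le> \<delta> \<Longrightarrow> norm (y - yb) \<le> \<delta> \<Longrightarrow> norm (B - A) \<le> \<delta> \<Longrightarrow>
           norm v = 1 \<Longrightarrow> norm p \<le> \<delta> \<Longrightarrow> norm q \<le> \<delta> \<Longrightarrow>
           p - transpose B *v v \<in> regular_normal_cone x C \<Longrightarrow>
           v + q \<in> regular_normal_cone y Q \<Longrightarrow> False"
proof (rule ccontr)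
  assume "\<not> thesis"
  with that have "\<exists>x y B v p q. norm (x - xb) \<le> \<delta> \<and> norm (y - yb) \<le> \<delta> \<and> norm (B - A) \<le> \<delta> \<and>
           norm v = 1 \<and> norm p \<le> \<delta> \<and> norm q \<le> \<delta> \<and>
           p - transpose B *v v \<in> regular_normal_cone x C \<and>
           v + q \<in> regular_normal_cone y Q" if "\<delta> > 0" for \<delta>
    using \<open>\<delta> > 0\<close> by blast
  then have "\<exists>x y B v p q. norm (x - xb) \<le> 1 / real (Suc k) \<and> norm (y - yb) \<le> 1 / real (Suc k) \<and>
           norm (B - A) \<le> 1 / real (Suc k) \<and>
           norm v = 1 \<and> norm p \<le> 1 / real (Suc k) \<and> norm q \<le> 1 / real (Suc k) \<and>
           p - transpose B *v v \<in> regular_normal_cone x C \<and>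
           v + q \<in> regular_normal_cone y Q" for k
    by simp
  then obtain x y B v p q where *:
    "\<And>k. norm (x k - xb) \<le> 1 / real (Suc k)" "\<And>k. norm (y k - yb) \<le> 1 / real (Suc k)"
    "\<And>k. norm (B k - A) \<le> 1 / real (Suc k)" "\<And>k. norm (v k) = 1"
    "\<And>k. norm (p k) \<le> 1 / real (Suc k)" "\<And>k. norm (q k) \<le> 1 / real (Suc k)"
    "\<And>k. p k - transpose (B k) *v v k \<in> regular_normal_cone (x k) C"
    "\<And>k. v k + q k \<in> regular_normal_cone (y k) Q"
    by metis
  have small: "u \<longlonglongrightarrow> l" if "\<And>k. norm (u k - l) \<le> 1 / real (Suc k)"
    for u :: "nat \<Rightarrow> 'z::real_normed_vector" and l
    by (rule LIM_zero_cancel, rule Lim_null_comparison[OF always_eventually LIMSEQ_Suc[OF lim_1_over_n]])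
       (use that in simp)
  have lim: "x \<longlonglongrightarrow> xb" "y \<longlonglongrightarrow> yb" "B \<longlonglongrightarrow> A" "p \<longlonglongrightarrow> 0" "q \<longlonglongrightarrow> 0"
    using *(1-3,5,6) by (auto intro!: small)
  \<comment> \<open>Normalising \<open>v\<close> keeps its limit away from zero: the unit sphere is
    compact and misses the origin.\<close>
  have "compact (sphere (0 :: real ^ 'm) 1)" "\<forall>k. v k \<in> sphere 0 1"
    using *(4) by auto
  then obtain w r where w: "w \<in> sphere 0 1" and r: "strict_mono r" and "(v \<circ> r) \<longlonglongrightarrow> w"
    by (meson compact_imp_seq_compact seq_compactE)
  have sub: "(\<lambda>k. u (r k)) \<longlonglongrightarrow> l" if "u \<longlonglongrightarrow> l" for u :: "nat \<Rightarrow> 'z::real_normed_vector" and l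
    using LIMSEQ_subseq_LIMSEQ[OF that r] by (simp add: o_def)
  have v: "(\<lambda>k. v (r k)) \<longlonglongrightarrow> w"
    using \<open>(v \<circ> r) \<longlonglongrightarrow> w\<close> by (simp add: o_def)
  have "bounded_linear (transpose :: real ^ 'n ^ 'm \<Rightarrow> _)"
    by (intro linear_conv_bounded_linear[THEN iffD1] linearI)
       (simp_all add: transpose_def vec_eq_iff)
  then have "(\<lambda>k. transpose (B (r k))) \<longlonglongrightarrow> transpose A"
    using sub[OF lim(3)] by (rule bounded_linear.tendsto)
  then have "(\<lambda>k. transpose (B (r k)) *v v (r k)) \<longlonglongrightarrow> transpose A *v w"
    using v by (rule bounded_bilinear.tendsto[OF bounded_bilinear_matrix_vector_mult])
  then have "(\<lambda>k. p (r k) - transpose (B (r k)) *v v (r k)) \<longlonglongrightarrow> 0 - transpose A *v w"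
    by (rule tendsto_diff[OF sub[OF lim(4)]])
  then have "0 - transpose A *v w \<in> limiting_normal_cone xb C"
    using *(7) by (rule limiting_normal_coneI[OF xb sub[OF lim(1)]])
  then have "- (transpose A *v w) \<in> limiting_normal_cone xb C"
    by (simp only: diff_0)
  moreover have "(\<lambda>k. v (r k) + q (r k)) \<longlonglongrightarrow> w + 0"
    by (rule tendsto_add[OF v sub[OF lim(5)]])
  then have "w + 0 \<in> limiting_normal_cone yb Q"
    using *(8) by (rule limiting_normal_coneI[OF yb sub[OF lim(2)]])
  then have "w \<in> limiting_normal_cone yb Q"
    by simp
  ultimately have "w = 0"
    by (rule cq)
  with w show False
    by simp
qed

text \<open>
  The quadratic penalty is differentiable everywhere, so that exact regular normals appear; its
  coefficient \<open>s\<^sup>2 / r\<close> makes its gradients at most \<open>2 s\<close> on the ball of radius \<open>r / s\<close>.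
\<close>

lemma feasible_point_near:
  fixes B :: "real ^ 'n ^ 'm"
  assumes C: "closed C" "x' \<in> C" and Q: "closed Q" "y' \<in> Q"
    and s: "s > 0" and r: "norm (B *v x' + c - y') = r"
    and reg: "\<And>x y v p q. norm (x - x') \<le> r / s \<Longrightarrow> norm (y - y') \<le> r / s \<Longrightarrow>
       norm v = 1 \<Longrightarrow> norm p \<le> 2 * s \<Longrightarrow> norm q \<le> 2 * s \<Longrightarrow>
       p - transpose B *v v \<in> regular_normal_cone x C \<Longrightarrow>
       v + q \<in> regular_normal_cone y Q \<Longrightarrow> False"
  obtains x where "x \<in> C" "B *v x + c \<in> Q" "norm (x - x') \<le> r / s"
proof (cases "r = 0")
  case True
  then have "B *v x' + c \<in> Q"
    using r Q by simp
  then show ?thesis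
    using that[of x'] C True by simp
next
  case False
  then have "r > 0"
    using r norm_ge_zero[of "B *v x' + c - y'"] by linarith
  define a where "a = s\<^sup>2 / r"
  have "a > 0"
    using \<open>r > 0\<close> s by (simp add: a_def)
  define f where "f = (\<lambda>x y. norm (B *v x + c - y) + a * (inner (x - x') (x - x') + inner (y - y') (y - y')))"
  \<comment> \<open>The sets \<open>C\<close> and \<open>Q\<close> may be unbounded, so a minimiser
    is first found on a compact piece.\<close>
  let ?K = "(C \<times> Q) \<inter> cball (x', y') (r / s)"
  have "compact ?K"
    by (intro closed_Int_compact closed_Times C Q compact_cball)
  moreover have "(x', y') \<in> ?K"
    using C Q \<open>r > 0\<close> s by simp
  moreover have "continuous_on ?K (\<lambda>z. f (fst z) (snd z))"
    unfolding f_def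
    by (intro continuous_intros bounded_linear.continuous_on[OF matrix_vector_mul_bounded_linear])
  ultimately obtain z where z: "z \<in> ?K" and "\<forall>w\<in>?K. f (fst z) (snd z) \<le> f (fst w) (snd w)"
    using continuous_attains_inf[of ?K] by blast
  then have zmin: "f (fst z) (snd z) \<le> f x y" if "(x, y) \<in> ?K" for x y
    using that by force
  obtain x y where xy: "z = (x, y)"
    by (cases z)
  have f': "f x' y' = r"
    using r by (simp add: f_def)
  have dist2: "(dist (x', y') (u, w))\<^sup>2 = inner (u - x') (u - x') + inner (w - y') (w - y')" for u w
    by (simp add: dist_norm norm_Pair norm_minus_commute power2_norm_eq_inner)
  \<comment> \<open>Outside the ball the penalty alone is at least
    \<open>a * (r / s)\<^sup>2 = r\<close>, the value of \<open>f\<close> at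
    \<open>(x', y')\<close>. Hence the minimiser over \<open>?K\<close> is global on
    \<open>C \<times> Q\<close>, and the normals found below belong to \<open>C\<close> and
    \<open>Q\<close> themselves rather than to truncations.\<close>
  have min: "f x y \<le> f u w" if "u \<in> C" "w \<in> Q" for u w
  proof (cases "(u, w) \<in> ?K")
    case True
    then show ?thesis
      using zmin xy by simp
  next
    case False
    then have "r / s < dist (x', y') (u, w)"
      using that by simp
    then have "(r / s)\<^sup>2 \<le> (dist (x', y') (u, w))\<^sup>2"
      using \<open>r > 0\<close> s by (intro power_mono) auto
    then have "a * (r / s)\<^sup>2 \<le> a * (inner (u - x') (u - x') + inner (w - y') (w - y'))"
      using \<open>a > 0\<close> by (simp add: dist2)
    moreover have "a * (r / s)\<^sup>2 = r"
      using \<open>r > 0\<close> s by (simp add: a_def field_simps power2_eq_square)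
    ultimately have "r \<le> f u w"
      unfolding f_def using norm_ge_zero[of "B *v u + c - w"] by linarith
    moreover have "f x y \<le> r"
      using zmin[OF \<open>(x', y') \<in> ?K\<close>] f' xy by simp
    ultimately show ?thesis
      by simp
  qed
  have "x \<in> C" "y \<in> Q"
    using z xy by auto
  have "norm (x - x', y - y') \<le> r / s"
    using z xy by (simp add: dist_commute flip: dist_norm[of "(x, y)" "(x', y')", simplified])
  then have near: "norm (x - x') \<le> r / s" "norm (y - y') \<le> r / s"
    using norm_fst_le[of "x - x'" "y - y'"] norm_snd_le[of "y - y'" "x - x'"] by linarith+
  show ?thesis
  proof (cases "B *v x + c = y")
    case True
    then show ?thesis
      using that \<open>x \<in> C\<close> \<open>y \<in> Q\<close> near by simp
  next
    case False
    \<comment> \<open>At a nonzero residual the norm is differentiable, and this unit vector is its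
      gradient.\<close>
    define v where "v = sgn (B *v x + c - y)"
    have nv: "norm v = 1"
      using False by (simp add: v_def norm_sgn)
    have sm: "norm ((2 * a) *\<^sub>R u) \<le> 2 * s" if "norm u \<le> r / s" for u :: "'z::real_normed_vector"
    proof -
      have "norm ((2 * a) *\<^sub>R u) \<le> (2 * a) * (r / s)"
        using that \<open>a > 0\<close> unfolding norm_scaleR by (intro mult_mono) auto
      also have "\<dots> = 2 * s"
        using \<open>r > 0\<close> s by (simp add: a_def field_simps power2_eq_square)
      finally show ?thesis .
    qed
    have nz: "B *v x + c - y \<noteq> 0"
      using False by simp
    have Bd: "((*v) B has_derivative (*v) B) (at x)"
      by (rule bounded_linear_imp_has_derivative[OF matrix_vector_mul_bounded_linear])
    \<comment> \<open>The constant \<open>d\<close> stands for the penalty of the other variable,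
      which is held fixed in each partial derivative.\<close>
    have penalty: "((\<lambda>u. a * (inner (u - l) (u - l) + d)) has_derivative
             (\<lambda>h. inner ((2 * a) *\<^sub>R (u - l)) h)) (at u)"
      for u l :: "'z::real_inner" and d
      by (auto intro!: derivative_eq_intros simp: inner_commute algebra_simps)
    have "((\<lambda>u. f u y) has_derivative
             (\<lambda>h. inner (transpose B *v v + (2 * a) *\<^sub>R (x - x')) h)) (at x)"
    proof -
      have "((\<lambda>u. B *v u + c - y) has_derivative (*v) B) (at x)"
        by (auto intro!: derivative_eq_intros Bd)
      from has_derivative_compose[OF this, OF has_derivative_norm[OF nz]]
      have "((\<lambda>u. norm (B *v u + c - y)) has_derivative (\<lambda>h. inner v (B *v h))) (at x)"
        unfolding v_def by (simp add: inner_commute)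
      from has_derivative_add[OF this penalty] show ?thesis
        unfolding f_def inner_add_left inner_transpose_matrix_vector .
    qed
    then have "- (transpose B *v v + (2 * a) *\<^sub>R (x - x')) \<in> regular_normal_cone x C"
      using \<open>x \<in> C\<close> min \<open>y \<in> Q\<close> by (intro minimiser_regular_normal[where f = "\<lambda>u. f u y"]) auto
    moreover have "((\<lambda>w. f x w) has_derivative (\<lambda>h. inner (- v + (2 * a) *\<^sub>R (y - y')) h)) (at y)"
    proof -
      have "((\<lambda>w. B *v x + c - w) has_derivative uminus) (at y)"
        by (auto intro!: derivative_eq_intros)
      from has_derivative_compose[OF this, OF has_derivative_norm[OF nz]]
      have "((\<lambda>w. norm (B *v x + c - w)) has_derivative (\<lambda>h. inner (- v) h)) (at y)"
        unfolding v_def by (simp add: inner_commute)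
      from has_derivative_add[OF this penalty] show ?thesis
        unfolding f_def inner_add_left add.commute[of "inner (x - x') (x - x')"] .
    qed
    then have "- (- v + (2 * a) *\<^sub>R (y - y')) \<in> regular_normal_cone y Q"
      using \<open>y \<in> Q\<close> min \<open>x \<in> C\<close> by (intro minimiser_regular_normal[where f = "\<lambda>w. f x w"]) auto
    \<comment> \<open>Brings the two normals into the form required by \<open>reg\<close>, with
      errors \<open>p = (2 * a) *\<^sub>R (x' - x)\<close> and
      \<open>q = (2 * a) *\<^sub>R (y' - y)\<close>.\<close>
    moreover have "- (transpose B *v v + (2 * a) *\<^sub>R (x - x')) = (2 * a) *\<^sub>R (x' - x) - transpose B *v v"
      "- (- v + (2 * a) *\<^sub>R (y - y')) = v + (2 * a) *\<^sub>R (y' - y)"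
      by (simp_all add: scaleR_diff_right)
    moreover have "norm (x' - x) \<le> r / s" "norm (y' - y) \<le> r / s"
      using near by (simp_all add: norm_minus_commute)
    ultimately have False
      using reg[OF near nv sm sm] by metis
    then show ?thesis ..
  qed
qed

text \<open>A solution for one parameter has residual \<open>r\<close> at most \<open>L\<close>
  times the parameter distance for the other, and \<open>feasible_point_near\<close> repairs it by a
  move of length at most \<open>r / s\<close>. This gives the modulus \<open>L / s\<close>.\<close>

lemma split_feasibility_lipschitz_like:
  fixes A :: "real ^ 'n ^ 'm"
  assumes C: "closed C" and Q: "closed Q"
    and xb: "xb \<in> split_feasibility_map C Q (A, b)"
    and cq: "\<And>v. - (transpose A *v v) \<in> limiting_normal_cone xb C \<Longrightarrow>
                 v \<in> limiting_normal_cone (A *v xb + b) Q \<Longrightarrow> v = 0"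
  shows "lipschitz_like_at sum_norm (split_feasibility_map C Q) (A, b) xb"
proof -
  define yb where "yb = A *v xb + b"
  have "xb \<in> C" "yb \<in> Q"
    using xb by (auto simp: split_feasibility_map_def yb_def)
  then obtain \<delta> where "\<delta> > 0" and \<delta>:
    "\<And>x y B v p q. norm (x - xb) \<le> \<delta> \<Longrightarrow> norm (y - yb) \<le> \<delta> \<Longrightarrow> norm (B - A) \<le> \<delta> \<Longrightarrow>
           norm v = 1 \<Longrightarrow> norm p \<le> \<delta> \<Longrightarrow> norm q \<le> \<delta> \<Longrightarrow>
           p - transpose B *v v \<in> regular_normal_cone x C \<Longrightarrow>
           v + q \<in> regular_normal_cone y Q \<Longrightarrow> False"
    using uniform_qualification[of xb C yb Q A] cq unfolding yb_def by metis
  \<comment> \<open>Makes the gradient bound \<open>2 * s\<close> equal to the tolerance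
    \<open>\<delta>\<close>.\<close>
  define s where "s = \<delta> / 2"
  have "s > 0"
    using \<open>\<delta> > 0\<close> by (simp add: s_def)
  define L where "L = norm xb + 1"
  have "L \<ge> 1"
    by (simp add: L_def)
  have "((\<lambda>w. fst (fst w) *v snd w + snd (fst w)) \<longlongrightarrow> fst (fst ((A, b), xb)) *v snd ((A, b), xb) + snd (fst ((A, b), xb)))
          (nhds ((A, b), xb))"
    by (intro tendsto_add bounded_bilinear.tendsto[OF bounded_bilinear_matrix_vector_mult]
          tendsto_fst tendsto_snd tendsto_ident_at filterlim_ident)
  then have "\<forall>\<^sub>F w in nhds ((A, b), xb). dist (fst (fst w) *v snd w + snd (fst w)) yb < \<delta> / 2"
    using \<open>\<delta> > 0\<close> unfolding yb_def fst_conv snd_conv by (intro tendstoD) simp_all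
  then obtain d where "d > 0" and d:
    "\<And>B c x. dist ((B, c), x) ((A, b), xb) < d \<Longrightarrow> dist (B *v x + c) yb < \<delta> / 2"
    unfolding eventually_nhds_metric by (metis fst_conv snd_conv)
  \<comment> \<open>The bound \<open>1\<close> ensures \<open>norm x' \<le> L\<close>;
    \<open>d / 2\<close> puts \<open>((A', b'), x')\<close> within \<open>d\<close> of the reference
    triple; \<open>\<delta> / 2\<close> leaves the other half of \<open>\<delta>\<close> for the
    move from \<open>x'\<close> to \<open>x\<close>; the last term makes that move at most
    \<open>\<delta> / 2\<close>.\<close>
  define \<eta> where "\<eta> = min (min 1 (d / 2)) (min (\<delta> / 2) (\<delta> * s / (8 * L)))"
  have "\<eta> > 0"
    using \<open>d > 0\<close> \<open>\<delta> > 0\<close> \<open>s > 0\<close> \<open>L \<ge> 1\<close> by (simp add: \<eta>_def)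
  have \<eta>: "\<eta> \<le> 1" "\<eta> \<le> d / 2" "\<eta> \<le> \<delta> / 2" "\<eta> \<le> \<delta> * s / (8 * L)"
    unfolding \<eta>_def by linarith+
  have approx: "\<exists>x. x \<in> split_feasibility_map C Q P \<and> norm (x' - x) \<le> L / s * sum_norm (P' - P)"
    if P': "P' \<in> ball (A, b) \<eta>" and P: "P \<in> ball (A, b) \<eta>"
      and x': "x' \<in> split_feasibility_map C Q P'" "x' \<in> ball xb \<eta>" for P P' x'
  proof -
    obtain A' b' B c where eqs: "P' = (A', b')" "P = (B, c)"
      by (cases P', cases P)
    define y' where "y' = A' *v x' + b'"
    have "x' \<in> C" "y' \<in> Q"
      using x' by (auto simp: split_feasibility_map_def y'_def eqs)
    have nx: "norm (x' - xb) < \<eta>"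
      using x' by (simp add: dist_norm norm_minus_commute)
    have "dist P' (A, b) < \<eta>" "dist P (A, b) < \<eta>"
      using P P' by (simp_all add: dist_commute)
    then have nP: "norm (A' - A, b' - b) < \<eta>" "norm (B - A, c - b) < \<eta>"
      by (simp_all add: dist_norm eqs)
    then have near: "norm (A' - A) < \<eta>" "norm (b' - b) < \<eta>" "norm (B - A) < \<eta>" "norm (c - b) < \<eta>"
      using norm_fst_le[of "A' - A" "b' - b"] norm_snd_le[of "b' - b" "A' - A"]
        norm_fst_le[of "B - A" "c - b"] norm_snd_le[of "c - b" "B - A"] by linarith+
    have "dist ((A', b'), x') ((A, b), xb) \<le> norm (A' - A, b' - b) + norm (x' - xb)"
      using norm_Pair_le[of "(A' - A, b' - b)" "x' - xb"] by (simp add: dist_norm)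
    then have "dist ((A', b'), x') ((A, b), xb) < d"
      using nP nx \<eta> by linarith
    then have ny: "norm (y' - yb) < \<delta> / 2"
      using d by (simp add: y'_def dist_norm)
    define r where "r = norm (B *v x' + c - y')"
    have "norm x' \<le> L"
      using nx \<eta>(1) norm_triangle_ineq2[of x' xb] by (simp add: L_def)
    \<comment> \<open>As \<open>y'\<close> is the exact image of \<open>x'\<close> under the first
      parameter, the residual is linear in the parameter difference.\<close>
    have "B *v x' + c - y' = (B - A') *v x' + (c - b')"
      by (simp add: y'_def matrix_vector_mult_diff_rdistrib)
    then have "r \<le> norm (B - A') * norm x' + norm (c - b')"
      unfolding r_def using norm_triangle_ineq norm_matrix_vector_mult_le
      by (metis (no_types, lifting) add_right_mono order_trans)
    also have "\<dots> \<le> norm (B - A') * L + norm (c - b') * L"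
      using \<open>norm x' \<le> L\<close> \<open>L \<ge> 1\<close> by (intro add_mono mult_left_mono mult_right_le_one_le) (auto simp: mult_le_cancel_left1)
    also have "\<dots> = L * sum_norm (P' - P)"
      by (simp add: sum_norm_def eqs norm_minus_commute algebra_simps)
    finally have rL: "r \<le> L * sum_norm (P' - P)" .
    \<comment> \<open>Each of the two components of \<open>P' - P\<close> is shorter than
      \<open>2 * \<eta>\<close>.\<close>
    have "sum_norm (P' - P) \<le> 4 * \<eta>"
      using near norm_triangle_ineq4[of "A' - A" "B - A"] norm_triangle_ineq4[of "b' - b" "c - b"]
      by (simp add: sum_norm_def eqs)
    then have "r \<le> L * (4 * \<eta>)"
      using rL \<open>L \<ge> 1\<close> by (meson mult_left_mono order_trans zero_le_one)
    also have "\<dots> \<le> L * (4 * (\<delta> * s / (8 * L)))"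
      using \<eta>(4) \<open>L \<ge> 1\<close> by (intro mult_left_mono) auto
    also have "\<dots> = (\<delta> / 2) * s"
      using \<open>L \<ge> 1\<close> by simp
    finally have rs: "r / s \<le> \<delta> / 2"
      using \<open>s > 0\<close> by (simp add: pos_divide_le_eq)
    obtain x where "x \<in> C" "B *v x + c \<in> Q" "norm (x - x') \<le> r / s"
    proof (rule feasible_point_near[OF C \<open>x' \<in> C\<close> Q \<open>y' \<in> Q\<close> \<open>s > 0\<close> r_def[symmetric]])
      fix x y v p q
      assume h: "norm (x - x') \<le> r / s" "norm (y - y') \<le> r / s" "norm v = 1"
        "norm p \<le> 2 * s" "norm q \<le> 2 * s"
        "p - transpose B *v v \<in> regular_normal_cone x C" "v + q \<in> regular_normal_cone y Q"
      have "norm (x - xb) \<le> norm (x - x') + norm (x' - xb)"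
        using norm_triangle_ineq[of "x - x'" "x' - xb"] by simp
      then have "norm (x - xb) \<le> \<delta>"
        using h(1) rs nx \<eta>(3) by linarith
      moreover have "norm (y - yb) \<le> norm (y - y') + norm (y' - yb)"
        using norm_triangle_ineq[of "y - y'" "y' - yb"] by simp
      then have "norm (y - yb) \<le> \<delta>"
        using h(2) rs ny by linarith
      moreover have "norm (B - A) \<le> \<delta>"
        using near(3) \<eta>(3) \<open>\<delta> > 0\<close> by linarith
      ultimately show False
        using \<delta> h(3-7) by (simp add: s_def del: transpose_matrix_vector)
    qed
    moreover have "r / s \<le> L / s * sum_norm (P' - P)"
      using rL \<open>s > 0\<close> by (simp add: divide_simps)
    ultimately show ?thesis
      by (intro exI[of _ x]) (auto simp: split_feasibility_map_def eqs norm_minus_commute)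
  qed
  have "split_feasibility_map C Q P' \<inter> ball xb \<eta> \<subseteq>
      {y + (L / s * sum_norm (P' - P)) *\<^sub>R u |y u. y \<in> split_feasibility_map C Q P \<and> u \<in> cball 0 1}"
    if PP: "P' \<in> ball (A, b) \<eta>" "P \<in> ball (A, b) \<eta>" for P P'
  proof
    fix x' assume "x' \<in> split_feasibility_map C Q P' \<inter> ball xb \<eta>"
    then obtain x where x: "x \<in> split_feasibility_map C Q P"
      and le: "norm (x' - x) \<le> L / s * sum_norm (P' - P)" (is "_ \<le> ?t")
      using approx[OF PP] by blast
    \<comment> \<open>If \<open>?t = 0\<close>, the bound \<open>le\<close> forces
      \<open>x' = x\<close>, and the convention \<open>inverse 0 = 0\<close> makes the chosen
      unit-ball vector zero.\<close>
    have "x' = x + ?t *\<^sub>R ((x' - x) /\<^sub>R ?t)"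
      using le by (cases "?t = 0") auto
    moreover have "norm ((x' - x) /\<^sub>R ?t) \<le> 1"
    proof (cases "?t = 0")
      case False
      then have "?t > 0"
        using le norm_ge_zero[of "x' - x"] by linarith
      have "norm ((x' - x) /\<^sub>R ?t) = norm (x' - x) / ?t"
        using \<open>?t > 0\<close> by (simp only: norm_scaleR abs_inverse abs_of_pos divide_inverse mult.commute)
      also have "\<dots> \<le> 1"
        using le \<open>?t > 0\<close> by (simp only: divide_le_eq_1_pos)
      finally show ?thesis .
    qed (simp only:, simp)
    ultimately show "x' \<in> {y + ?t *\<^sub>R u |y u. y \<in> split_feasibility_map C Q P \<and> u \<in> cball 0 1}"
      using x by (auto simp only: mem_cball_0)
  qed
  moreover have "L / s > 0"
    using \<open>s > 0\<close> \<open>L \<ge> 1\<close> by simp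
  ultimately show ?thesis
    unfolding lipschitz_like_at_def using xb \<open>\<eta> > 0\<close>
    by (intro conjI exI[of _ "ball (A, b) \<eta>"] exI[of _ "ball xb \<eta>"] exI[of _ "L / s"] ballI)
       (auto simp only: open_ball centre_in_ball)
qed

section \<open>Necessity of the qualification condition\<close>

text \<open>Formulated for regular normals because their defining inequalities can be evaluated
  directly at nearby points; normal regularity later identifies them with the limiting
  normals.\<close>

lemma lipschitz_like_imp_qualification:
  fixes A :: "real ^ 'n ^ 'm"
  assumes lip: "lipschitz_like_at sum_norm (split_feasibility_map C Q) (A, b) xb"
    and vC: "- (transpose A *v v) \<in> regular_normal_cone xb C"
    and vQ: "v \<in> regular_normal_cone (A *v xb + b) Q"
  shows "v = 0"
proof (rule ccontr)
  assume "v \<noteq> 0"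
  define yb where "yb = A *v xb + b"
  have xb: "xb \<in> split_feasibility_map C Q (A, b)"
    using lip by (simp add: lipschitz_like_at_def)
  from lip obtain U V \<kappa> where "open U" "(A, b) \<in> U" "xb \<in> V" "\<kappa> > 0"
    and sub: "\<forall>P'\<in>U. \<forall>P\<in>U. split_feasibility_map C Q P' \<inter> V \<subseteq>
      {y + (\<kappa> * sum_norm (P' - P)) *\<^sub>R u |y u. y \<in> split_feasibility_map C Q P \<and> u \<in> cball 0 1}"
    unfolding lipschitz_like_at_def by (elim conjE exE)
  obtain \<rho> where "\<rho> > 0" and \<rho>: "ball (A, b) \<rho> \<subseteq> U"
    using \<open>open U\<close> \<open>(A, b) \<in> U\<close> open_contains_ball by blast
  \<comment> \<open>When \<open>b\<close> is shifted by a vector of norm \<open>T\<close>, the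
    solution moves by at most \<open>\<kappa> * T\<close> and its image by at most
    \<open>M * T\<close>. The choice of \<open>e\<close> then gives
    \<open>e * (\<kappa> + M) = norm v / 2\<close>.\<close>
  define M where "M = norm A * \<kappa> + 1"
  define e where "e = norm v / (2 * (\<kappa> + M))"
  have "M > 0"
    using \<open>\<kappa> > 0\<close> by (simp add: M_def add_nonneg_pos)
  then have "e > 0"
    using \<open>\<kappa> > 0\<close> \<open>v \<noteq> 0\<close> by (simp add: e_def)
  obtain d1 where "d1 > 0" and d1: "\<And>x. x \<in> C \<Longrightarrow> norm (x - xb) < d1 \<Longrightarrow>
      inner (- (transpose A *v v)) (x - xb) \<le> e * norm (x - xb)"
    using vC \<open>e > 0\<close> unfolding regular_normal_cone_iff by blast
  obtain d2 where "d2 > 0" and d2: "\<And>y. y \<in> Q \<Longrightarrow> norm (y - yb) < d2 \<Longrightarrow>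
      inner v (y - yb) \<le> e * norm (y - yb)"
    using vQ \<open>e > 0\<close> unfolding regular_normal_cone_iff yb_def by blast
  \<comment> \<open>Small enough that the shifted parameter stays in \<open>U\<close> and the
    displacements \<open>\<kappa> * T\<close> and \<open>M * T\<close> stay below \<open>d1\<close>
    and \<open>d2\<close>; the factors 2 make these bounds strict.\<close>
  define T where "T = min (\<rho> / 2) (min (d1 / (2 * \<kappa>)) (d2 / (2 * M)))"
  have "T > 0"
    using \<open>\<rho> > 0\<close> \<open>d1 > 0\<close> \<open>d2 > 0\<close> \<open>\<kappa> > 0\<close> \<open>M > 0\<close> by (simp add: T_def)
  have "T \<le> \<rho> / 2" "T \<le> d1 / (2 * \<kappa>)" "T \<le> d2 / (2 * M)"
    unfolding T_def by linarith+
  then have T: "T < \<rho>" "\<kappa> * T < d1" "M * T < d2"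
    using \<open>\<rho> > 0\<close> \<open>d1 > 0\<close> \<open>d2 > 0\<close> \<open>\<kappa> > 0\<close> \<open>M > 0\<close> by (auto simp: field_simps)
  define t where "t = T / norm v"
  have "t > 0" and tT: "t * norm v = T"
    using \<open>T > 0\<close> \<open>v \<noteq> 0\<close> by (auto simp: t_def)
  have inU: "(A, b + t *\<^sub>R v) \<in> U"
    using \<rho> T tT \<open>t > 0\<close> by (auto simp: dist_norm norm_Pair)
  have "sum_norm ((A, b) - (A, b + t *\<^sub>R v)) = T"
    using tT \<open>t > 0\<close> by (simp add: sum_norm_def)
  \<comment> \<open>The reference parameter takes the role of \<open>P'\<close>, so
    \<open>xb\<close> itself is approximated by a solution of the shifted problem.\<close>
  with bspec[OF bspec[OF sub \<open>(A, b) \<in> U\<close>] inU]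
  have "split_feasibility_map C Q (A, b) \<inter> V \<subseteq>
      {y + (\<kappa> * T) *\<^sub>R u |y u. y \<in> split_feasibility_map C Q (A, b + t *\<^sub>R v) \<and> u \<in> cball 0 1}"
    by (simp only:)
  then have "xb \<in> {y + (\<kappa> * T) *\<^sub>R u |y u. y \<in> split_feasibility_map C Q (A, b + t *\<^sub>R v) \<and> u \<in> cball 0 1}"
    using IntI[OF xb \<open>xb \<in> V\<close>] by (rule subsetD)
  then obtain x u where x: "x \<in> split_feasibility_map C Q (A, b + t *\<^sub>R v)"
    and u: "norm u \<le> 1" and xu: "xb = x + (\<kappa> * T) *\<^sub>R u"
    by (auto simp only: mem_Collect_eq mem_cball_0)
  define y where "y = A *v x + (b + t *\<^sub>R v)"
  have "x \<in> C" "y \<in> Q"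
    using x by (auto simp: split_feasibility_map_def y_def)
  have nx: "norm (x - xb) \<le> \<kappa> * T"
    using u xu \<open>\<kappa> > 0\<close> \<open>T > 0\<close> by (simp add: mult_left_le)
  have yy: "y - yb = A *v (x - xb) + t *\<^sub>R v"
    by (simp add: y_def yb_def matrix_vector_mult_diff_distrib)
  have "norm (y - yb) \<le> norm A * norm (x - xb) + T"
    using norm_triangle_ineq[of "A *v (x - xb)" "t *\<^sub>R v"] norm_matrix_vector_mult_le[of A "x - xb"]
      tT \<open>t > 0\<close> by (simp add: yy)
  also have "\<dots> \<le> norm A * (\<kappa> * T) + T"
    using nx by (simp add: mult_left_mono)
  also have "\<dots> = M * T"
    by (simp add: M_def algebra_simps)
  finally have ny: "norm (y - yb) \<le> M * T" .
  have "inner (- (transpose A *v v)) (x - xb) \<le> e * (\<kappa> * T)"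
    using d1[OF \<open>x \<in> C\<close>] nx T \<open>e > 0\<close> by (smt (verit) mult_left_mono)
  moreover have "inner v (y - yb) \<le> e * (M * T)"
    using d2[OF \<open>y \<in> Q\<close>] ny T \<open>e > 0\<close> by (smt (verit) mult_left_mono)
  \<comment> \<open>The two terms with \<open>A *v (x - xb)\<close> cancel, leaving only the
    contribution of the shift.\<close>
  moreover have "inner (- (transpose A *v v)) (x - xb) + inner v (y - yb) = t * (norm v)\<^sup>2"
    by (simp only: inner_minus_left inner_transpose_matrix_vector yy inner_add_right
          inner_scaleR_right power2_norm_eq_inner)
  moreover have "e * (\<kappa> * T) + e * (M * T) = e * (\<kappa> + M) * T"
    by (simp add: algebra_simps)
  moreover have "\<kappa> + M \<noteq> 0"
    using \<open>\<kappa> > 0\<close> \<open>M > 0\<close> by linarith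
  then have "e * (\<kappa> + M) = norm v / 2"
    by (simp add: e_def del: distrib_left distrib_right distrib_left_numeral)
  then have "e * (\<kappa> + M) * T = norm v * T / 2"
    by (simp only: times_divide_eq_left)
  moreover have "t * (norm v)\<^sup>2 = norm v * T"
    using tT by (simp add: power2_eq_square)
  moreover have "norm v * T > 0"
    using \<open>v \<noteq> 0\<close> \<open>T > 0\<close> by simp
  \<comment> \<open>The estimates combine to \<open>norm v * T \<le> norm v * T / 2\<close>,
    although \<open>norm v * T\<close> is positive.\<close>
  ultimately show False
    by linarith
qed

theorem theorem4p1:
  fixes C :: "(real ^ 'n) set" and Q :: "(real ^ 'm) set"
    and A :: "real ^ 'n ^ 'm" and b :: "real ^ 'm" and xb :: "real ^ 'n"
  assumes "C \<noteq> {}" and "closed C" and "Q \<noteq> {}" and "closed Q"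
    and "xb \<in> split_feasibility_map C Q (A, b)"
    and "normally_regular_at C xb"
    and "normally_regular_at Q (A *v xb + b)"
  shows "((\<lambda>v. transpose A *v v) -` (uminus ` limiting_normal_cone xb C)
            \<inter> limiting_normal_cone (A *v xb + b) Q = {0}
          \<longrightarrow> lipschitz_like_at sum_norm (split_feasibility_map C Q) (A, b) xb)
       \<and> (lipschitz_like_at sum_norm (split_feasibility_map C Q) (A, b) xb \<and> xb \<noteq> 0
          \<longrightarrow> (\<lambda>v. transpose A *v v) -` (uminus ` limiting_normal_cone xb C)
            \<inter> limiting_normal_cone (A *v xb + b) Q = {0})"
proof -
  \<comment> \<open>The simp rule \<open>transpose_matrix_vector\<close> is disabled, since it would
    rewrite \<open>transpose A *v v\<close> to \<open>v v* A\<close>.\<close>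
  have memC: "v \<in> (\<lambda>v. transpose A *v v) -` (uminus ` limiting_normal_cone xb C) \<longleftrightarrow>
      - (transpose A *v v) \<in> limiting_normal_cone xb C" for v
    by (force simp del: transpose_matrix_vector)
  have pt: "xb \<in> C" "A *v xb + b \<in> Q"
    using assms(5) by (auto simp: split_feasibility_map_def)
  \<comment> \<open>Zero always lies in the intersection, so the condition amounts to the absence of
    any other element.\<close>
  have zero: "0 \<in> (\<lambda>v. transpose A *v v) -` (uminus ` limiting_normal_cone xb C)
            \<inter> limiting_normal_cone (A *v xb + b) Q"
    using zero_in_limiting_normal_cone[OF pt(1)] zero_in_limiting_normal_cone[OF pt(2)]
    by (simp add: memC del: transpose_matrix_vector vimage_eq)
  show ?thesis
  proof (intro conjI impI)
    assume "(\<lambda>v. transpose A *v v) -` (uminus ` limiting_normal_cone xb C)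
            \<inter> limiting_normal_cone (A *v xb + b) Q = {0}"
    then have "v = 0" if "- (transpose A *v v) \<in> limiting_normal_cone xb C"
      "v \<in> limiting_normal_cone (A *v xb + b) Q" for v
      using that memC by blast
    then show "lipschitz_like_at sum_norm (split_feasibility_map C Q) (A, b) xb"
      using assms(2,4,5) by (intro split_feasibility_lipschitz_like)
  next
    assume "lipschitz_like_at sum_norm (split_feasibility_map C Q) (A, b) xb \<and> xb \<noteq> 0"
    then have "v = 0" if "- (transpose A *v v) \<in> limiting_normal_cone xb C"
      "v \<in> limiting_normal_cone (A *v xb + b) Q" for v
      \<comment> \<open>Normal regularity of both sets turns the given limiting normals into regular
        ones.\<close>
      using that assms(6,7) lipschitz_like_imp_qualification[of C Q A b xb v]
      unfolding normally_regular_at_def by blast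
    then show "(\<lambda>v. transpose A *v v) -` (uminus ` limiting_normal_cone xb C)
            \<inter> limiting_normal_cone (A *v xb + b) Q = {0}"
      using zero memC by blast
  qed
qed

end
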